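(* Let $n\geq 2$ and let $B_n$ be the braid group on $n$ strands with standard generators $g_1,\ldots,g_{n-1}$. For an integer $k\geq 1$ let $B_n[k]$ denote the normal subgroup of $B_n$ generated by $g_1^k,\ldots,g_{n-1}^k$. Then $\bigcap_{k\geq 1} B_n[k]=\{1\}$.
   Context: $B_n$ has the standard Artin presentation with generators $g_1,\ldots,g_{n-1}$, relations $g_ig_{i+1}g_i=g_{i+1}g_ig_{i+1}$ and $g_ig_j=g_jg_i$ for $|i-j|\geq 2$. *)

theory Defs
  imports "HOL-Algebra.Algebra"
begin

text \<open>Words in the Artin generators: a letter (i, True) stands for g_i,
  a letter (i, False) for the inverse of g_i.\<close>
type_synonym bword = "(nat \<times> bool) list"

definition valid_word :: "nat \<Rightarrow> bword \<Rightarrow> bool" where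
  "valid_word n w \<longleftrightarrow> (\<forall>(i, e) \<in> set w. 1 \<le> i \<and> i < n)"

inductive braid_eq :: "nat \<Rightarrow> bword \<Rightarrow> bword \<Rightarrow> bool" for n where
  refl: "braid_eq n w w"
| sym: "braid_eq n u v \<Longrightarrow> braid_eq n v u"
| trans: "braid_eq n u v \<Longrightarrow> braid_eq n v w \<Longrightarrow> braid_eq n u w"
| ctxt: "braid_eq n u v \<Longrightarrow> braid_eq n (a @ u @ b) (a @ v @ b)"
| cancel: "1 \<le> i \<Longrightarrow> i < n \<Longrightarrow> braid_eq n [(i, e), (i, \<not> e)] []"
| braid: "1 \<le> i \<Longrightarrow> i + 1 < n \<Longrightarrow>
     braid_eq n [(i, True), (i + 1, True), (i, True)] [(i + 1, True), (i, True), (i + 1, True)]"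
| comm: "1 \<le> i \<Longrightarrow> i < n \<Longrightarrow> 1 \<le> j \<Longrightarrow> j < n \<Longrightarrow> i + 2 \<le> j \<Longrightarrow>
     braid_eq n [(i, True), (j, True)] [(j, True), (i, True)]"

definition braid_rel :: "nat \<Rightarrow> (bword \<times> bword) set" where
  "braid_rel n = {(u, v). valid_word n u \<and> valid_word n v \<and> braid_eq n u v}"

definition braid_class :: "nat \<Rightarrow> bword \<Rightarrow> bword set" where
  "braid_class n w = braid_rel n `` {w}"

definition braid_mult :: "nat \<Rightarrow> bword set \<Rightarrow> bword set \<Rightarrow> bword set" where
  "braid_mult n P Q = braid_class n ((SOME u. u \<in> P) @ (SOME v. v \<in> Q))"

definition braid_group :: "nat \<Rightarrow> bword set monoid" where
  "braid_group n =
     \<lparr> carrier = {w. valid_word n w} // braid_rel n,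
       monoid.mult = braid_mult n,
       monoid.one = braid_class n [] \<rparr>"

definition braid_gen :: "nat \<Rightarrow> nat \<Rightarrow> bword set" where
  "braid_gen n i = braid_class n [(i, True)]"

definition braid_congr_sub :: "nat \<Rightarrow> nat \<Rightarrow> bword set set" where
  "braid_congr_sub n k =
     generate (braid_group n)
       {x \<otimes>\<^bsub>braid_group n\<^esub> (braid_gen n i [^]\<^bsub>braid_group n\<^esub> k)
          \<otimes>\<^bsub>braid_group n\<^esub> inv\<^bsub>braid_group n\<^esub> x
        | x i. x \<in> carrier (braid_group n) \<and> 1 \<le> i \<and> i < n}"

end

theory Submission
  imports Defs "HOL-Combinatorics.Perm"
begin

unbundle permutation_syntax

text \<open>
  In any finite quotient the generators have finite order, so it suffices that nontrivial braids
  act nontrivially on some finite set. Braids act on \<open>X\<^sup>n\<close> for the finite racks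
  \<open>X = Sym(Y) \<squnion> Y\<close>, where \<open>Sym(Y)\<close> acts on itself by conjugation and on \<open>Y\<close> naturally, and \<open>Y\<close> acts
  trivially. Suppose \<open>w\<close> acts trivially on all of them. Combing writes \<open>w = u v c\<^sub>j\<close> with \<open>u\<close> a word in
  the pure generators \<open>A\<^sub>i\<close> winding the last strand around the \<open>i\<close>-th, \<open>v\<close> a braid on one strand
  fewer, and \<open>c\<^sub>j\<close> moving strand \<open>j\<close> to the end. Following the position of a point \<open>y \<in> Y\<close> shows that
  \<open>c\<^sub>j = 1\<close>. As \<open>A\<^sub>i\<close> sends \<open>(x\<^sub>1, \<dots>, x\<^sub>m, y)\<close> to \<open>(x\<^sub>1, \<dots>, x\<^sub>m, x\<^sub>i \<cdot> y)\<close>, the braid \<open>v\<close> acts trivially, hence is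
  trivial by induction, and \<open>u\<close> is trivial already as a free word, since free groups are residually
  finite.
\<close>

section \<open>The braid group as a quotient of words\<close>

definition word_inv :: "bword \<Rightarrow> bword" where
  "word_inv w = rev (map (\<lambda>(i, e). (i, \<not> e)) w)"

lemma word_inv_simps [simp]:
  "word_inv [] = []"
  "word_inv ((i, e) # w) = word_inv w @ [(i, \<not> e)]"
  "word_inv (u @ v) = word_inv v @ word_inv u"
  by (simp_all add: word_inv_def)

lemma valid_word_simps [simp]:
  "valid_word n []"
  "valid_word n ((i, e) # w) \<longleftrightarrow> 1 \<le> i \<and> i < n \<and> valid_word n w"
  "valid_word n (u @ v) \<longleftrightarrow> valid_word n u \<and> valid_word n v"
  by (auto simp: valid_word_def)

lemma valid_word_inv [simp]: "valid_word n (word_inv w) \<longleftrightarrow> valid_word n w"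
  by (induction w) auto

lemma word_inv_inv [simp]: "word_inv (word_inv w) = w"
  by (induction w) auto

lemma braid_eq_append:
  assumes "braid_eq n u u'" "braid_eq n v v'"
  shows "braid_eq n (u @ v) (u' @ v')"
  using braid_eq.ctxt[OF assms(1), of "[]" v] braid_eq.ctxt[OF assms(2), of u' "[]"]
  by (auto intro: braid_eq.trans)

lemma braid_eq_word_inv_right: "valid_word n w \<Longrightarrow> braid_eq n (w @ word_inv w) []"
proof (induction w)
  case (Cons l w)
  obtain i e where l: "l = (i, e)" by fastforce
  have "braid_eq n ([(i, e)] @ (w @ word_inv w) @ [(i, \<not> e)]) ([(i, e)] @ [] @ [(i, \<not> e)])"
    using Cons l by (intro braid_eq.ctxt) simp
  then show ?case
    using braid_eq.trans braid_eq.cancel Cons.prems l by fastforce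
qed (simp add: braid_eq.refl)

lemma braid_eq_word_inv_left: "valid_word n w \<Longrightarrow> braid_eq n (word_inv w @ w) []"
  using braid_eq_word_inv_right[of n "word_inv w"] by simp

lemma equiv_braid_rel: "equiv {w. valid_word n w} (braid_rel n)"
  by (auto simp: equiv_def refl_on_def sym_def trans_def braid_rel_def
      intro: braid_eq.refl braid_eq.sym braid_eq.trans)

lemma braid_class_eq_iff:
  assumes "valid_word n u" "valid_word n v"
  shows "braid_class n u = braid_class n v \<longleftrightarrow> braid_eq n u v"
  using eq_equiv_class_iff[OF equiv_braid_rel, of u n v] assms
  by (simp add: braid_class_def) (simp add: braid_rel_def)

lemma carrier_braid_group: "carrier (braid_group n) = braid_class n ` {w. valid_word n w}"
  by (auto simp: braid_group_def quotient_def braid_class_def)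

lemma braid_class_in_carrier [simp]:
  "valid_word n w \<Longrightarrow> braid_class n w \<in> carrier (braid_group n)"
  by (simp add: carrier_braid_group)

lemma one_braid_group: "\<one>\<^bsub>braid_group n\<^esub> = braid_class n []"
  by (simp add: braid_group_def)

text \<open>\<open>braid_mult\<close> multiplies arbitrarily chosen representatives; this fact lets
  the choice be replaced by any known word, as in \<open>mult_braid_class\<close>.\<close>

lemma some_in_braid_class:
  assumes "valid_word n u"
  shows "valid_word n (SOME x. x \<in> braid_class n u)" "braid_eq n u (SOME x. x \<in> braid_class n u)"
proof -
  have "u \<in> braid_class n u"
    using assms by (simp add: braid_class_def braid_rel_def braid_eq.refl)
  then have "(SOME x. x \<in> braid_class n u) \<in> braid_class n u"
    by (rule someI)
  then show "valid_word n (SOME x. x \<in> braid_class n u)" "braid_eq n u (SOME x. x \<in> braid_class n u)"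
    by (auto simp: braid_class_def braid_rel_def)
qed

lemma mult_braid_class:
  assumes "valid_word n u" "valid_word n v"
  shows "braid_class n u \<otimes>\<^bsub>braid_group n\<^esub> braid_class n v = braid_class n (u @ v)"
  using assms some_in_braid_class[OF assms(1)] some_in_braid_class[OF assms(2)]
  by (simp add: braid_group_def braid_mult_def braid_class_eq_iff braid_eq.sym braid_eq_append)

lemma group_braid_group: "group (braid_group n)"
proof (rule groupI)
  fix x y z
  assume "x \<in> carrier (braid_group n)" "y \<in> carrier (braid_group n)" "z \<in> carrier (braid_group n)"
  then show "x \<otimes>\<^bsub>braid_group n\<^esub> y \<otimes>\<^bsub>braid_group n\<^esub> z
      = x \<otimes>\<^bsub>braid_group n\<^esub> (y \<otimes>\<^bsub>braid_group n\<^esub> z)"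
    by (auto simp: carrier_braid_group mult_braid_class)
next
  fix x
  assume "x \<in> carrier (braid_group n)"
  then obtain w where "valid_word n w" "x = braid_class n w"
    by (auto simp: carrier_braid_group)
  then show "\<exists>y\<in>carrier (braid_group n). y \<otimes>\<^bsub>braid_group n\<^esub> x = \<one>\<^bsub>braid_group n\<^esub>"
    by (intro bexI[of _ "braid_class n (word_inv w)"])
      (simp_all add: mult_braid_class one_braid_group braid_class_eq_iff braid_eq_word_inv_left)
qed (auto simp: carrier_braid_group mult_braid_class one_braid_group)

lemma inv_braid_class:
  assumes "valid_word n w"
  shows "inv\<^bsub>braid_group n\<^esub> braid_class n w = braid_class n (word_inv w)"
  by (rule group.inv_equality[OF group_braid_group])
    (use assms in \<open>simp_all add: mult_braid_class one_braid_group braid_class_eq_iff braid_eq_word_inv_left\<close>)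

lemma pow_braid_class:
  assumes "valid_word n w"
  shows "braid_class n w [^]\<^bsub>braid_group n\<^esub> (k::nat) = braid_class n (concat (replicate k w))
    \<and> valid_word n (concat (replicate k w))"
proof (induction k)
  case 0
  then show ?case
    using group.is_monoid[OF group_braid_group] by (simp add: monoid.nat_pow_0 one_braid_group)
next
  case (Suc k)
  \<comment> \<open>Group powers multiply the new factor on the right, whereas
    \<open>replicate\<close> adds it on the left.\<close>
  have "concat (replicate k w) @ w = w @ concat (replicate k w)"
    by (induction k) auto
  with Suc assms show ?case
    by (simp add: mult_braid_class)
qed

section \<open>Substituting words for generators\<close>

definition word_subst :: "(nat \<Rightarrow> bword) \<Rightarrow> bword \<Rightarrow> bword" where
  "word_subst f w = concat (map (\<lambda>(i, e). if e then f i else word_inv (f i)) w)"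

lemma word_subst_simps [simp]:
  "word_subst f [] = []"
  "word_subst f ((i, e) # w) = (if e then f i else word_inv (f i)) @ word_subst f w"
  "word_subst f (u @ v) = word_subst f u @ word_subst f v"
  by (simp_all add: word_subst_def)

lemma valid_word_subst:
  assumes "\<And>i. 1 \<le> i \<Longrightarrow> i < m \<Longrightarrow> valid_word n (f i)"
  shows "valid_word m w \<Longrightarrow> valid_word n (word_subst f w)"
  by (induction w) (auto simp: assms)

lemma generate_braid_class:
  assumes "x \<in> generate (braid_group n) ((\<lambda>i. braid_class n (f i)) ` {1..<m})"
    and f: "\<And>i. 1 \<le> i \<Longrightarrow> i < m \<Longrightarrow> valid_word n (f i)"
  shows "\<exists>w. valid_word m w \<and> x = braid_class n (word_subst f w)"
  using assms(1)
proof (induction rule: generate.induct)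
  case one
  show ?case
    by (intro exI[of _ "[]"]) (simp add: one_braid_group)
next
  case (incl h)
  then obtain i where "1 \<le> i" "i < m" "h = braid_class n (f i)" by auto
  then show ?case
    by (intro exI[of _ "[(i, True)]"]) simp
next
  case (inv h)
  then obtain i where "1 \<le> i" "i < m" "h = braid_class n (f i)" by auto
  then show ?case
    by (intro exI[of _ "[(i, False)]"]) (simp add: inv_braid_class f)
next
  case (eng h1 h2)
  then obtain u v where "valid_word m u" "h1 = braid_class n (word_subst f u)"
      "valid_word m v" "h2 = braid_class n (word_subst f v)"
    by blast
  then show ?case
    by (intro exI[of _ "u @ v"]) (simp add: mult_braid_class valid_word_subst[OF f])
qed

section \<open>Combing\<close>

text \<open>\<open>U\<close> plays the role of the free group of the fibration forgetting the last strand, \<open>B\<close> that of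
  the braid group on one strand fewer, and the \<open>c j\<close> represent the cosets of \<open>U B\<close>. Only the
  factorisation is needed, not that \<open>U\<close> is free or meets \<open>B\<close> trivially.\<close>

locale braid_combing = group G for G (structure) +
  fixes g c :: "nat \<Rightarrow> 'a" and m :: nat
  assumes g_closed [simp]: "1 \<le> i \<Longrightarrow> i \<le> m \<Longrightarrow> g i \<in> carrier G"
    and braid: "1 \<le> i \<Longrightarrow> Suc i \<le> m \<Longrightarrow> g i \<otimes> g (Suc i) \<otimes> g i = g (Suc i) \<otimes> g i \<otimes> g (Suc i)"
    and comm: "1 \<le> i \<Longrightarrow> i + 2 \<le> j \<Longrightarrow> j \<le> m \<Longrightarrow> g i \<otimes> g j = g j \<otimes> g i"
    and c_top [simp]: "c (Suc m) = \<one>"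
    and c_rec: "1 \<le> j \<Longrightarrow> j \<le> m \<Longrightarrow> c j = c (Suc j) \<otimes> g j"
begin

text \<open>By \<open>c_rec\<close>, \<open>c j\<close> is the product g_m ... g_j, so
  \<open>A j\<close> is the classical pure braid generator winding strand \<open>m + 1\<close> once
  around strand \<open>j\<close>.\<close>

definition A :: "nat \<Rightarrow> 'a" where
  "A j = c (Suc j) \<otimes> g j \<otimes> g j \<otimes> inv (c (Suc j))"

abbreviation U :: "'a set" where "U \<equiv> generate G (A ` {1..m})"
abbreviation B :: "'a set" where "B \<equiv> generate G (g ` {1..<m})"

lemma c_closed [simp]: "1 \<le> j \<Longrightarrow> j \<le> Suc m \<Longrightarrow> c j \<in> carrier G"
proof (induction "Suc m - j" arbitrary: j)
  case 0
  then have "j = Suc m" by simp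
  then show ?case by simp
next
  case (Suc d)
  then have j: "j \<le> m" by simp
  have "c (Suc j) \<in> carrier G"
    using Suc.hyps(2) j by (intro Suc.hyps(1)) auto
  then show ?case
    using Suc.prems(1) j by (simp add: c_rec[of j])
qed

lemma A_closed [simp]: "1 \<le> j \<Longrightarrow> j \<le> m \<Longrightarrow> A j \<in> carrier G"
  by (simp add: A_def)

text \<open>Every letter of \<open>c j\<close> has index at least \<open>j\<close>, hence at least
  \<open>i + 2\<close>, and so commutes with \<open>g i\<close>.\<close>

lemma c_comm:
  assumes "1 \<le> i" "i + 2 \<le> j" "j \<le> Suc m"
  shows "c j \<otimes> g i = g i \<otimes> c j"
  using assms
proof (induction "Suc m - j" arbitrary: j)
  case 0
  then have "j = Suc m" by simp
  with 0 show ?case by simp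
next
  case (Suc d)
  then have j: "j \<le> m" by simp
  have "c j \<otimes> g i = c (Suc j) \<otimes> (g j \<otimes> g i)"
    using Suc.prems j by (simp add: c_rec m_assoc)
  also have "\<dots> = c (Suc j) \<otimes> g i \<otimes> g j"
    using Suc.prems j by (simp add: comm[symmetric] m_assoc)
  also have "c (Suc j) \<otimes> g i = g i \<otimes> c (Suc j)"
    using Suc.prems Suc.hyps(2) j by (intro Suc.hyps(1)) auto
  also have "g i \<otimes> c (Suc j) \<otimes> g j = g i \<otimes> c j"
    using Suc.prems j by (simp add: c_rec m_assoc)
  finally show ?case .
qed

text \<open>Coming from the right, \<open>g (Suc i)\<close> commutes past g_j, ..., g_(i-1), becomes
  \<open>g i\<close> through one braid relation with the letters g_(i+1) g_i, and then commutes with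
  the rest by \<open>c_comm\<close>.\<close>

lemma c_shift:
  assumes "1 \<le> j" "j \<le> i" "Suc i \<le> m"
  shows "c j \<otimes> g (Suc i) = g i \<otimes> c j"
  using assms
proof (induction "i - j" arbitrary: j)
  case 0
  then have [simp]: "j = i" by simp
  have br: "g i \<otimes> g (Suc i) \<otimes> g i = g (Suc i) \<otimes> g i \<otimes> g (Suc i)"
    using 0 by (intro braid) auto
  have "c i \<otimes> g (Suc i) = c (Suc (Suc i)) \<otimes> (g (Suc i) \<otimes> g i \<otimes> g (Suc i))"
    using 0 by (simp add: c_rec m_assoc)
  also have "\<dots> = (c (Suc (Suc i)) \<otimes> g i) \<otimes> g (Suc i) \<otimes> g i"
    using 0 br by (simp add: m_assoc)
  also have "c (Suc (Suc i)) \<otimes> g i = g i \<otimes> c (Suc (Suc i))"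
    using 0 by (intro c_comm) auto
  also have "g i \<otimes> c (Suc (Suc i)) \<otimes> g (Suc i) \<otimes> g i = g i \<otimes> c i"
    using 0 by (simp add: c_rec m_assoc)
  finally show ?case by simp
next
  case (Suc d)
  then have j: "Suc j \<le> i" by simp
  have "c j \<otimes> g (Suc i) = c (Suc j) \<otimes> (g j \<otimes> g (Suc i))"
    using Suc.prems j by (simp add: c_rec m_assoc)
  also have "\<dots> = c (Suc j) \<otimes> g (Suc i) \<otimes> g j"
    using Suc.prems j comm[of j "Suc i"] by (simp add: m_assoc)
  also have "c (Suc j) \<otimes> g (Suc i) = g i \<otimes> c (Suc j)"
    using Suc.prems Suc.hyps(2) j by (intro Suc.hyps(1)) auto
  also have "g i \<otimes> c (Suc j) \<otimes> g j = g i \<otimes> c j"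
    using Suc.prems j by (simp add: c_rec m_assoc)
  finally show ?case .
qed

lemma inv_move:
  assumes "x \<otimes> y = z \<otimes> x" "x \<in> carrier G" "y \<in> carrier G" "z \<in> carrier G"
  shows "x \<otimes> inv y = inv z \<otimes> x"
proof -
  have "y = inv x \<otimes> (z \<otimes> x)"
    using assms by (simp add: inv_solve_left)
  then have "inv y = inv x \<otimes> inv z \<otimes> x"
    using assms by (simp add: inv_mult_group m_assoc)
  then show ?thesis
    using assms by (simp add: m_assoc[symmetric])
qed

lemma conj_eq_iff:
  assumes "x \<in> carrier G" "y \<in> carrier G" "z \<in> carrier G"
  shows "x \<otimes> y \<otimes> inv x = z \<longleftrightarrow> x \<otimes> y = z \<otimes> x"
  using assms by (metis inv_solve_right m_closed)

lemma A_mult_c: "1 \<le> j \<Longrightarrow> j \<le> m \<Longrightarrow> A j \<otimes> c (Suc j) = c j \<otimes> g j"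
  by (simp add: A_def c_rec m_assoc)

text \<open>Pushing \<open>g i\<close> through \<open>c (Suc j)\<close> leaves a generator
  \<open>h\<close> that commutes with \<open>g j\<close>: \<open>g i\<close> itself for
  \<open>i < j\<close>, and \<open>g (Suc i)\<close> by \<open>c_shift\<close> for
  \<open>i > j\<close>.\<close>

lemma conj_A_far:
  assumes "1 \<le> i" "i < m" "1 \<le> j" "j \<le> m" "i \<noteq> j" "Suc i \<noteq> j"
  shows "g i \<otimes> A j = A j \<otimes> g i"
proof -
  obtain h where h: "h \<in> carrier G" "g i \<otimes> c (Suc j) = c (Suc j) \<otimes> h" "h \<otimes> g j = g j \<otimes> h"
  proof (cases "i < j")
    case True
    then show ?thesis
      using assms that[of "g i"] c_comm[of i "Suc j"] comm[of i j] by simp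
  next
    case False
    then show ?thesis
      using assms that[of "g (Suc i)"] c_shift[of "Suc j" i] comm[of j "Suc i"] by simp
  qed
  have hx: "h \<otimes> (g j \<otimes> x) = g j \<otimes> (h \<otimes> x)" if "x \<in> carrier G" for x
    using assms h that by (simp flip: m_assoc)
  have "g i \<otimes> A j = (g i \<otimes> c (Suc j)) \<otimes> (g j \<otimes> g j \<otimes> inv (c (Suc j)))"
    using assms by (simp add: A_def m_assoc)
  also have "\<dots> = c (Suc j) \<otimes> g j \<otimes> g j \<otimes> (h \<otimes> inv (c (Suc j)))"
    using assms h(1) by (simp add: h(2) hx m_assoc)
  also have "h \<otimes> inv (c (Suc j)) = inv (c (Suc j)) \<otimes> g i"
  proof -
    have "h = inv (c (Suc j)) \<otimes> (g i \<otimes> c (Suc j))"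
      using assms h by (simp add: inv_solve_left)
    then show ?thesis
      using assms by (simp add: m_assoc)
  qed
  finally show ?thesis
    using assms by (simp add: A_def m_assoc)
qed

text \<open>The two-generator core of \<open>conj_A_near\<close>: for \<open>a = g j\<close> and
  \<open>b = g (Suc j)\<close>, the elements b a a b^-1 and b b become \<open>A j\<close> and
  \<open>A (Suc j)\<close> after conjugation by \<open>c (Suc (Suc j))\<close>.\<close>

lemma braid_squares:
  assumes "a \<in> carrier G" "b \<in> carrier G" and br: "a \<otimes> b \<otimes> a = b \<otimes> a \<otimes> b"
  shows "a \<otimes> (b \<otimes> a \<otimes> a \<otimes> inv b) = b \<otimes> b \<otimes> a"
    and "a \<otimes> (b \<otimes> a \<otimes> a \<otimes> inv b \<otimes> (b \<otimes> b)) = b \<otimes> a \<otimes> a \<otimes> inv b \<otimes> (b \<otimes> b) \<otimes> a"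
proof -
  have br': "a \<otimes> (b \<otimes> a) = b \<otimes> (a \<otimes> b)" "x \<in> carrier G \<Longrightarrow> a \<otimes> (b \<otimes> (a \<otimes> x)) = b \<otimes> (a \<otimes> (b \<otimes> x))" for x
    using assms by (simp_all flip: m_assoc)
  show "a \<otimes> (b \<otimes> a \<otimes> a \<otimes> inv b) = b \<otimes> b \<otimes> a"
    using assms(1,2) by (simp add: m_assoc br')
  have "inv b \<otimes> (b \<otimes> x) = x" if "x \<in> carrier G" for x
    using assms(2) that by (simp flip: m_assoc)
  then show "a \<otimes> (b \<otimes> a \<otimes> a \<otimes> inv b \<otimes> (b \<otimes> b)) = b \<otimes> a \<otimes> a \<otimes> inv b \<otimes> (b \<otimes> b) \<otimes> a"
    using assms(1,2) by (simp add: m_assoc br')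
qed

text \<open>The second identity complements the first: as \<open>g j\<close> commutes with the
  product, its conjugate of \<open>A (Suc j)\<close> and the inverse conjugate of \<open>A j\<close>
  are determined too.\<close>

lemma conj_A_near:
  assumes "1 \<le> j" "Suc j \<le> m"
  shows "g j \<otimes> A j = A (Suc j) \<otimes> g j"
    and "g j \<otimes> (A j \<otimes> A (Suc j)) = A j \<otimes> A (Suc j) \<otimes> g j"
proof -
  define a b d where "a = g j" "b = g (Suc j)" "d = c (Suc (Suc j))"
  have cl: "a \<in> carrier G" "b \<in> carrier G" "d \<in> carrier G"
    using assms by (auto simp: a_b_d_def)
  have br: "a \<otimes> b \<otimes> a = b \<otimes> a \<otimes> b"
    using assms braid by (simp add: a_b_d_def)
  have ad: "a \<otimes> d = d \<otimes> a"
    using assms by (simp add: a_b_d_def c_comm)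
  have ad': "inv d \<otimes> a = a \<otimes> inv d"
    using inv_move[of a d d] ad cl by simp
  have A1: "A j = d \<otimes> (b \<otimes> a \<otimes> a \<otimes> inv b) \<otimes> inv d"
    using assms cl by (simp add: A_def c_rec inv_mult_group m_assoc flip: a_b_d_def)
  have A2: "A (Suc j) = d \<otimes> (b \<otimes> b) \<otimes> inv d"
    using assms cl by (simp add: A_def m_assoc flip: a_b_d_def)
  have A12: "A j \<otimes> A (Suc j) = d \<otimes> (b \<otimes> a \<otimes> a \<otimes> inv b \<otimes> (b \<otimes> b)) \<otimes> inv d"
    using cl by (simp add: A1 A2 m_assoc) (simp flip: m_assoc)
  \<comment> \<open>Because \<open>a\<close> commutes with \<open>d\<close>, a relation a x = y a
    survives conjugating \<open>x\<close> and \<open>y\<close> by \<open>d\<close>.\<close>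
  have mv: "a \<otimes> (d \<otimes> x \<otimes> inv d) = d \<otimes> y \<otimes> inv d \<otimes> a"
    if "x \<in> carrier G" "y \<in> carrier G" "a \<otimes> x = y \<otimes> a" for x y
  proof -
    have "a \<otimes> (d \<otimes> x \<otimes> inv d) = a \<otimes> d \<otimes> (x \<otimes> inv d)"
      using that(1,2) cl by (simp add: m_assoc)
    also have "\<dots> = d \<otimes> (a \<otimes> x) \<otimes> inv d"
      using that(1,2) cl by (simp only: ad) (simp add: m_assoc)
    also have "\<dots> = d \<otimes> y \<otimes> inv d \<otimes> a"
      using that(1,2) cl by (simp add: that(3) ad' m_assoc)
    finally show ?thesis .
  qed
  show "g j \<otimes> A j = A (Suc j) \<otimes> g j"
    unfolding A1 A2 a_b_d_def(1)[symmetric]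
    using cl by (intro mv braid_squares(1) br) auto
  show "g j \<otimes> (A j \<otimes> A (Suc j)) = A j \<otimes> A (Suc j) \<otimes> g j"
    unfolding A12 a_b_d_def(1)[symmetric]
    using cl by (intro mv braid_squares(2) br) auto
qed

section \<open>The subgroup \<open>U\<close> is normalised by \<open>B\<close>\<close>

lemma U_closed: "x \<in> U \<Longrightarrow> x \<in> carrier G"
  by (rule generate_in_carrier) auto

lemma B_closed: "x \<in> B \<Longrightarrow> x \<in> carrier G"
  by (rule generate_in_carrier) auto

lemma subgroup_U: "subgroup U G"
  by (rule generate_is_subgroup) auto

lemma A_in_U: "1 \<le> j \<Longrightarrow> j \<le> m \<Longrightarrow> A j \<in> U"
  by (rule generate.incl) auto

lemma g_in_B: "1 \<le> i \<Longrightarrow> i < m \<Longrightarrow> g i \<in> B" "1 \<le> i \<Longrightarrow> i < m \<Longrightarrow> inv (g i) \<in> B"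
  by (rule generate.incl generate.inv, simp)+

text \<open>This is Artin's action on the free group: up to conjugation inside \<open>U\<close>,
  \<open>g i\<close> swaps \<open>A i\<close> and \<open>A (Suc i)\<close>, and it fixes the others.
  Both signs are treated, since mapping \<open>U\<close> into itself under \<open>g i\<close> would
  not by itself give the same for its inverse.\<close>

lemma conj_A_in_U:
  assumes "1 \<le> i" "i < m" "1 \<le> j" "j \<le> m"
  shows "g i \<otimes> A j \<otimes> inv (g i) \<in> U" "inv (g i) \<otimes> A j \<otimes> g i \<in> U"
proof -
  note U_mult = subgroup.m_closed[OF subgroup_U] and U_inv = subgroup.m_inv_closed[OF subgroup_U]
  have cl: "g i \<in> carrier G" "A j \<in> carrier G" "A i \<in> carrier G" "A (Suc i) \<in> carrier G"
    using assms by auto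
  have conj_mult: "inv (g i) \<otimes> (x \<otimes> y) \<otimes> g i = (inv (g i) \<otimes> x \<otimes> g i) \<otimes> (inv (g i) \<otimes> y \<otimes> g i)"
    "g i \<otimes> (x \<otimes> y) \<otimes> inv (g i) = (g i \<otimes> x \<otimes> inv (g i)) \<otimes> (g i \<otimes> y \<otimes> inv (g i))"
    if "x \<in> carrier G" "y \<in> carrier G" for x y
  proof -
    have "inv (g i) \<otimes> (g i \<otimes> z) = z" "g i \<otimes> (inv (g i) \<otimes> z) = z" if "z \<in> carrier G" for z
      using cl that by (simp_all flip: m_assoc)
    then show "inv (g i) \<otimes> (x \<otimes> y) \<otimes> g i = (inv (g i) \<otimes> x \<otimes> g i) \<otimes> (inv (g i) \<otimes> y \<otimes> g i)"
      "g i \<otimes> (x \<otimes> y) \<otimes> inv (g i) = (g i \<otimes> x \<otimes> inv (g i)) \<otimes> (g i \<otimes> y \<otimes> inv (g i))"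
      using cl that by (simp_all add: m_assoc)
  qed
  have conjI1: "g i \<otimes> x \<otimes> inv (g i) = y" and conjI2: "inv (g i) \<otimes> y \<otimes> g i = x"
    if "g i \<otimes> x = y \<otimes> g i" "x \<in> carrier G" "y \<in> carrier G" for x y
  proof -
    show "g i \<otimes> x \<otimes> inv (g i) = y"
      using that cl conj_eq_iff[of "g i" x y] by blast
    show "inv (g i) \<otimes> y \<otimes> g i = x"
      using that(2,3) cl by (simp add: m_assoc inv_solve_left' that(1))
  qed
  have AS: "inv (g i) \<otimes> A (Suc i) \<otimes> g i = A i" "g i \<otimes> A i \<otimes> inv (g i) = A (Suc i)"
    by (rule conjI2 conjI1, rule conj_A_near(1), use assms cl in auto)+
  have AU: "A i \<in> U" "A (Suc i) \<in> U"
    using assms by (auto simp del: One_nat_def intro!: A_in_U)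
  consider "i \<noteq> j" "Suc i \<noteq> j" | "j = i" | "j = Suc i" by blast
  then have "g i \<otimes> A j \<otimes> inv (g i) \<in> U \<and> inv (g i) \<otimes> A j \<otimes> g i \<in> U"
  proof cases
    case 1
    then show ?thesis
      using conj_A_far[of i j] conjI1[of "A j" "A j"] conjI2[of "A j" "A j"] assms A_in_U[of j] by simp
  next
    case 2
    have "inv (g i) \<otimes> (A i \<otimes> A (Suc i)) \<otimes> g i = A i \<otimes> A (Suc i)"
      using conj_A_near(2)[of i] assms cl by (intro conjI2) auto
    then have "inv (g i) \<otimes> A i \<otimes> g i = A i \<otimes> A (Suc i) \<otimes> inv (A i)"
      using cl by (simp add: conj_mult AS inv_solve_right)
    then show ?thesis
      unfolding \<open>j = i\<close> AS(2) using AU by (auto simp del: One_nat_def intro!: U_mult U_inv)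
  next
    case 3
    have "g i \<otimes> (A i \<otimes> A (Suc i)) \<otimes> inv (g i) = A i \<otimes> A (Suc i)"
      using conj_A_near(2)[of i] assms cl by (intro conjI1) auto
    then have "g i \<otimes> A (Suc i) \<otimes> inv (g i) = inv (A (Suc i)) \<otimes> (A i \<otimes> A (Suc i))"
      using cl by (simp add: conj_mult AS inv_solve_left)
    then show ?thesis
      unfolding \<open>j = Suc i\<close> AS(1) using AU by (auto simp del: One_nat_def intro!: U_mult U_inv)
  qed
  then show "g i \<otimes> A j \<otimes> inv (g i) \<in> U" "inv (g i) \<otimes> A j \<otimes> g i \<in> U"
    by auto
qed

text \<open>Conjugation respects products and inverses, so the generators of \<open>U\<close>
  decide.\<close>

lemma conj_in_U:
  assumes "x \<in> carrier G" "\<And>j. 1 \<le> j \<Longrightarrow> j \<le> m \<Longrightarrow> x \<otimes> A j \<otimes> inv x \<in> U" "u \<in> U"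
  shows "x \<otimes> u \<otimes> inv x \<in> U"
  using assms(3)
proof (induction rule: generate.induct)
  case one
  then show ?case
    using assms(1) by (simp add: generate.one)
next
  case (incl h)
  then show ?case
    using assms(2) by auto
next
  case (inv h)
  then obtain j where j: "1 \<le> j" "j \<le> m" "h = A j" by auto
  have "x \<otimes> inv h \<otimes> inv x = inv (x \<otimes> h \<otimes> inv x)"
    using assms(1) j by (simp add: inv_mult_group m_assoc)
  then show ?case
    using subgroup.m_inv_closed[OF subgroup_U assms(2)] j by simp
next
  case (eng h1 h2)
  then have cl: "h1 \<in> carrier G" "h2 \<in> carrier G"
    using U_closed by auto
  have "inv x \<otimes> (x \<otimes> z) = z" if "z \<in> carrier G" for z
    using assms(1) that by (simp flip: m_assoc)
  then have "x \<otimes> (h1 \<otimes> h2) \<otimes> inv x = (x \<otimes> h1 \<otimes> inv x) \<otimes> (x \<otimes> h2 \<otimes> inv x)"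
    using assms(1) cl by (simp add: m_assoc)
  then show ?case
    using subgroup.m_closed[OF subgroup_U eng.IH] by simp
qed

lemma B_normalizes_U:
  assumes "b \<in> B" "u \<in> U"
  shows "b \<otimes> u \<otimes> inv b \<in> U"
  using assms
proof (induction arbitrary: u rule: generate.induct)
  case one
  then show ?case
    using U_closed by simp
next
  case (incl h)
  then obtain i where i: "1 \<le> i" "i < m" "h = g i" by auto
  show ?case
    by (rule conj_in_U[OF _ _ incl.prems]) (use i conj_A_in_U[of i] in auto)
next
  case (inv h)
  then obtain i where i: "1 \<le> i" "i < m" "h = g i" by auto
  show ?case
    by (rule conj_in_U[OF _ _ inv.prems]) (use i conj_A_in_U[of i] in auto)
next
  case (eng h1 h2)
  have cl: "h1 \<in> carrier G" "h2 \<in> carrier G" "u \<in> carrier G"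
    using B_closed U_closed eng by auto
  have "(h1 \<otimes> h2) \<otimes> u \<otimes> inv (h1 \<otimes> h2) = h1 \<otimes> (h2 \<otimes> u \<otimes> inv h2) \<otimes> inv h1"
    using cl by (simp add: inv_mult_group m_assoc)
  then show ?case
    using eng by simp
qed

section \<open>Coset representatives and the combed form\<close>

text \<open>The representative changes only for \<open>j = i\<close> and \<open>j = Suc i\<close>,
  with correction \<open>\<one>\<close>, \<open>A i\<close> or its inverse. Otherwise
  \<open>c j\<close> stays and \<open>h\<close> is g_i or g_(i-1) or an inverse of these; its index
  is below \<open>m\<close>, which puts it in \<open>B\<close>.\<close>

lemma c_mult_g:
  assumes "1 \<le> j" "j \<le> Suc m" "1 \<le> i" "i \<le> m"
  shows "\<exists>h \<in> U \<union> B. \<exists>l. 1 \<le> l \<and> l \<le> Suc m \<and> c j \<otimes> g i = h \<otimes> c l"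
    and "\<exists>h \<in> U \<union> B. \<exists>l. 1 \<le> l \<and> l \<le> Suc m \<and> c j \<otimes> inv (g i) = h \<otimes> c l"
proof -
  have one: "\<one> \<in> U \<union> B" by (simp add: generate.one)
  consider "j = i" | "j = Suc i" | "i + 2 \<le> j" | "j < i" by linarith
  then have "(\<exists>h \<in> U \<union> B. \<exists>l. 1 \<le> l \<and> l \<le> Suc m \<and> c j \<otimes> g i = h \<otimes> c l)
    \<and> (\<exists>h \<in> U \<union> B. \<exists>l. 1 \<le> l \<and> l \<le> Suc m \<and> c j \<otimes> inv (g i) = h \<otimes> c l)"
  proof cases
    case 1
    have "c j \<otimes> g i = A i \<otimes> c (Suc i)"
      using 1 assms A_mult_c[of i] by simp
    moreover have "c j \<otimes> inv (g i) = \<one> \<otimes> c (Suc i)"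
      using 1 assms c_rec[of i] by (simp add: m_assoc)
    moreover have "A i \<in> U \<union> B" "1 \<le> Suc i" "Suc i \<le> Suc m"
      using A_in_U[of i] assms by auto
    ultimately show ?thesis using one by blast
  next
    case 2
    have "c j \<otimes> g i = \<one> \<otimes> c i"
      using 2 assms c_rec[of i] by simp
    moreover have "c j \<otimes> inv (g i) = inv (A i) \<otimes> c i"
    proof -
      have "c (Suc i) = inv (A i) \<otimes> (c i \<otimes> g i)"
        using A_mult_c[of i] assms by (simp add: inv_solve_left)
      then show ?thesis
        using 2 assms by (simp add: m_assoc)
    qed
    moreover have "inv (A i) \<in> U \<union> B"
      using subgroup.m_inv_closed[OF subgroup_U A_in_U[of i]] assms by simp
    ultimately show ?thesis using one assms by (metis le_SucI)
  next
    case 3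
    have "c j \<otimes> g i = g i \<otimes> c j"
      using 3 assms by (intro c_comm) auto
    moreover from this have "c j \<otimes> inv (g i) = inv (g i) \<otimes> c j"
      using assms by (intro inv_move) auto
    moreover have "g i \<in> U \<union> B" "inv (g i) \<in> U \<union> B"
      using assms 3 g_in_B[of i] by auto
    ultimately show ?thesis using assms(1,2) by blast
  next
    case 4
    then obtain k where k: "i = Suc k" "j \<le> k" by (cases i) auto
    have "c j \<otimes> g i = g k \<otimes> c j"
      using k assms c_shift by simp
    moreover from this have "c j \<otimes> inv (g i) = inv (g k) \<otimes> c j"
      using assms k by (intro inv_move) auto
    moreover have "g k \<in> U \<union> B" "inv (g k) \<in> U \<union> B"
      using assms k g_in_B[of k] by auto
    ultimately show ?thesis using assms(1,2) by blast
  qed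
  then show "\<exists>h \<in> U \<union> B. \<exists>l. 1 \<le> l \<and> l \<le> Suc m \<and> c j \<otimes> g i = h \<otimes> c l"
    "\<exists>h \<in> U \<union> B. \<exists>l. 1 \<le> l \<and> l \<le> Suc m \<and> c j \<otimes> inv (g i) = h \<otimes> c l"
    by auto
qed

definition combed :: "'a set" where
  "combed = {u \<otimes> b \<otimes> c j | u b j. u \<in> U \<and> b \<in> B \<and> 1 \<le> j \<and> j \<le> Suc m}"

lemma combedI: "u \<in> U \<Longrightarrow> b \<in> B \<Longrightarrow> 1 \<le> j \<Longrightarrow> j \<le> Suc m \<Longrightarrow> u \<otimes> b \<otimes> c j \<in> combed"
  unfolding combed_def by blast

lemma combedE:
  assumes "s \<in> combed"
  obtains u b j where "s = u \<otimes> b \<otimes> c j" "u \<in> U" "b \<in> B" "1 \<le> j" "j \<le> Suc m"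
  using assms unfolding combed_def by blast

lemma combed_closed: "s \<in> combed \<Longrightarrow> s \<in> carrier G"
  using U_closed B_closed by (elim combedE) simp

text \<open>A factor from \<open>B\<close> is absorbed by \<open>b\<close>; a factor from
  \<open>U\<close> moves left past \<open>b\<close> as its conjugate, which
  \<open>B_normalizes_U\<close> keeps in \<open>U\<close>.\<close>

lemma combed_mult:
  assumes "u \<in> U" "b \<in> B" "h \<in> U \<union> B" "1 \<le> l" "l \<le> Suc m"
  shows "u \<otimes> b \<otimes> (h \<otimes> c l) \<in> combed"
proof (cases "h \<in> U")
  case True
  have cl: "u \<in> carrier G" "b \<in> carrier G" "h \<in> carrier G" "c l \<in> carrier G"
    using assms True U_closed B_closed by auto
  have "inv b \<otimes> (b \<otimes> z) = z" if "z \<in> carrier G" for z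
    using cl that by (simp flip: m_assoc)
  then have "u \<otimes> b \<otimes> (h \<otimes> c l) = (u \<otimes> (b \<otimes> h \<otimes> inv b)) \<otimes> b \<otimes> c l"
    using cl by (simp add: m_assoc)
  then show ?thesis
    using combedI[OF generate.eng[OF assms(1) B_normalizes_U[OF assms(2) True]] assms(2,4,5)] by simp
next
  case False
  then have "h \<in> B" using assms by simp
  then have "u \<otimes> b \<otimes> (h \<otimes> c l) = u \<otimes> (b \<otimes> h) \<otimes> c l"
    using assms U_closed B_closed by (simp add: m_assoc)
  then show ?thesis
    using combedI[OF assms(1) generate.eng[OF assms(2) \<open>h \<in> B\<close>] assms(4,5)] by simp
qed

lemma combed_mult_generate:
  assumes "x \<in> generate G (g ` {1..m})" "s \<in> combed"
  shows "s \<otimes> x \<in> combed"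
  using assms
proof (induction arbitrary: s rule: generate.induct)
  case one
  then show ?case
    using combed_closed by simp
next
  case (incl h)
  obtain i where i: "1 \<le> i" "i \<le> m" "h = g i" using incl.hyps by auto
  obtain u b j where s: "s = u \<otimes> b \<otimes> c j" "u \<in> U" "b \<in> B" "1 \<le> j" "j \<le> Suc m"
    using combedE[OF incl.prems] .
  obtain k l where k: "k \<in> U \<union> B" "1 \<le> l" "l \<le> Suc m" "c j \<otimes> g i = k \<otimes> c l"
    using c_mult_g(1)[OF s(4,5) i(1,2)] by blast
  have "s \<otimes> g i = u \<otimes> b \<otimes> (k \<otimes> c l)"
    using i(1,2) s(4,5) U_closed[OF s(2)] B_closed[OF s(3)] by (simp add: s(1) m_assoc flip: k(4))
  then show ?case
    using combed_mult[OF s(2,3) k(1-3)] i(3) by simp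
next
  case (inv h)
  obtain i where i: "1 \<le> i" "i \<le> m" "h = g i" using inv.hyps by auto
  obtain u b j where s: "s = u \<otimes> b \<otimes> c j" "u \<in> U" "b \<in> B" "1 \<le> j" "j \<le> Suc m"
    using combedE[OF inv.prems] .
  obtain k l where k: "k \<in> U \<union> B" "1 \<le> l" "l \<le> Suc m" "c j \<otimes> inv (g i) = k \<otimes> c l"
    using c_mult_g(2)[OF s(4,5) i(1,2)] by blast
  have "s \<otimes> inv (g i) = u \<otimes> b \<otimes> (k \<otimes> c l)"
    using i(1,2) s(4,5) U_closed[OF s(2)] B_closed[OF s(3)] by (simp add: s(1) m_assoc flip: k(4))
  then show ?case
    using combed_mult[OF s(2,3) k(1-3)] i(3) by simp
next
  case (eng h1 h2)
  have "s \<in> carrier G"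
    using combed_closed eng.prems .
  moreover have "h1 \<in> carrier G" "h2 \<in> carrier G"
    by (rule generate_in_carrier[OF _ eng.hyps(1)] generate_in_carrier[OF _ eng.hyps(2)], force)+
  ultimately have "s \<otimes> (h1 \<otimes> h2) = s \<otimes> h1 \<otimes> h2"
    by (simp add: m_assoc)
  then show ?case
    using eng by simp
qed

text \<open>The combed set contains \<open>\<one>\<close>, because
  \<open>c (Suc m) = \<one>\<close>, and is stable under right multiplication by the generated
  subgroup.\<close>

theorem generate_subset_combed: "generate G (g ` {1..m}) \<subseteq> combed"
proof
  fix x
  assume x: "x \<in> generate G (g ` {1..m})"
  have "\<one> \<in> combed"
    using combedI[OF generate.one generate.one, of "Suc m"] by simp
  then show "x \<in> combed"
    using combed_mult_generate[OF x \<open>\<one> \<in> combed\<close>] generate_in_carrier[OF _ x] by force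
qed

end

section \<open>A rack action of braid words\<close>

text \<open>A permutation acts on permutations by conjugation and on numbers by evaluation; a number acts
  trivially. On tuples, \<open>g\<^sub>i\<close> sends \<open>(a, b)\<close> at \<open>(i, i + 1)\<close> to \<open>(a \<cdot> b, a)\<close>.\<close>

type_synonym point = "nat Perm.perm + nat"

fun rack_act :: "nat Perm.perm \<Rightarrow> point \<Rightarrow> point" where
  "rack_act p (Inl q) = Inl (p * q * inverse p)"
| "rack_act p (Inr y) = Inr (p \<langle>$\<rangle> y)"

fun label :: "point \<Rightarrow> nat Perm.perm" where
  "label (Inl q) = q"
| "label (Inr y) = 1"

lemma perm_inverse_cancel [simp]:
  fixes p q :: "'a Perm.perm"
  shows "inverse p * (p * q) = q" "p * (inverse p * q) = q"
  by (simp_all flip: mult.assoc)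

lemma apply_inverse_cancel [simp]:
  "p \<langle>$\<rangle> (inverse p \<langle>$\<rangle> y) = y" "inverse p \<langle>$\<rangle> (p \<langle>$\<rangle> y) = y"
  by (simp_all add: apply_sequence)

lemma rack_act_times: "rack_act (p * q) x = rack_act p (rack_act q x)"
  by (cases x) (simp_all add: mult.assoc apply_times)

lemma rack_act_one [simp]: "rack_act 1 x = x"
  by (cases x) simp_all

lemma rack_act_inverse [simp]:
  "rack_act p (rack_act (inverse p) x) = x" "rack_act (inverse p) (rack_act p x) = x"
  by (simp_all flip: rack_act_times)

text \<open>This expresses the self-distributivity a.(b.c) = (a.b).(a.c) of the rack, on which the
  braid relation rests.\<close>

lemma label_rack_act: "label (rack_act p x) = p * label x * inverse p"
  by (cases x) simp_all

text \<open>The \<open>False\<close> branch is the inverse map, taking (a, b) to (b, b^-1 .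
  a).\<close>

definition step :: "nat \<Rightarrow> bool \<Rightarrow> (nat \<Rightarrow> point) \<Rightarrow> nat \<Rightarrow> point" where
  "step i e x = (if e then x(i := rack_act (label (x i)) (x (Suc i)), Suc i := x i)
     else x(i := x (Suc i), Suc i := rack_act (inverse (label (x (Suc i)))) (x i)))"

definition word_act :: "bword \<Rightarrow> (nat \<Rightarrow> point) \<Rightarrow> nat \<Rightarrow> point" where
  "word_act w = foldr (\<lambda>(i, e). step i e) w"

lemma word_act_simps [simp]:
  "word_act [] x = x"
  "word_act ((i, e) # w) x = step i e (word_act w x)"
  "word_act (u @ v) x = word_act u (word_act v x)"
  by (simp_all add: word_act_def)

lemma step_inverse: "step i e (step i (\<not> e) x) = x"
  by (cases e) (auto simp: step_def fun_eq_iff)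

lemma word_act_inv [simp]: "word_act (word_inv w) (word_act w x) = x"
proof (induction w arbitrary: x)
  case (Cons l w)
  obtain i e where "l = (i, e)" by fastforce
  then show ?case
    using Cons step_inverse[of i "\<not> e"] by simp
qed simp

lemma word_act_cong: "braid_eq n u v \<Longrightarrow> word_act u x = word_act v x"
proof (induction arbitrary: x rule: braid_eq.induct)
  \<comment> \<open>On three adjacent entries (a, b, c) both sides give (a.(b.c), a.b, a); the left
    side produces the first entry as (a.b).(a.c).\<close>
  case (braid i)
  then show ?case
    by (auto simp: step_def fun_eq_iff label_rack_act mult.assoc simp flip: rack_act_times)
next
  case (comm i j)
  then show ?case
    by (auto simp: step_def fun_eq_iff)
qed (auto simp: step_inverse)

section \<open>Finite invariant sets of configurations\<close>

text \<open>This is the finite rack for \<open>Y = {..N}\<close>. Permutations and numbers share the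
  bound \<open>N\<close>, so that the former act on the latter.\<close>

definition points :: "nat \<Rightarrow> point set" where
  "points N = Inl ` {p. affected p \<subseteq> {..N}} \<union> Inr ` {..N}"

text \<open>The entries outside \<open>{1..n}\<close> are frozen to make the set finite.\<close>

definition confs :: "nat \<Rightarrow> nat \<Rightarrow> (nat \<Rightarrow> point) set" where
  "confs n N = {x. \<forall>i. (i \<in> {1..n} \<longrightarrow> x i \<in> points N) \<and> (i \<notin> {1..n} \<longrightarrow> x i = Inr 0)}"

lemma finite_points: "finite (points N)"
proof -
  have "finite {p :: nat Perm.perm. affected p \<subseteq> {..N}}"
  proof (rule inj_on_finite)
    show "inj_on Perm.apply {p :: nat Perm.perm. affected p \<subseteq> {..N}}"
      by (auto intro!: inj_onI perm_eqI)
    show "Perm.apply ` {p. affected p \<subseteq> {..N}} \<subseteq> {f. f permutes {..N}}"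
    proof (intro image_subsetI CollectI)
      fix p :: "nat Perm.perm"
      assume "p \<in> {p. affected p \<subseteq> {..N}}"
      then have "p \<langle>$\<rangle> y = y" if "y \<notin> {..N}" for y
        using that in_affected[of y p] by blast
      moreover have "\<exists>!x. p \<langle>$\<rangle> x = y" for y
        using bij_apply[of p] by (simp only: bij_iff)
      ultimately show "Perm.apply p permutes {..N}"
        by (simp add: permutes_def)
    qed
  qed (simp add: finite_permutations)
  then show ?thesis
    by (simp add: points_def)
qed

lemma finite_confs: "finite (confs n N)"
  unfolding confs_def by (rule finite_set_of_finite_funs) (simp_all add: finite_points)

lemma apply_closed:
  fixes p :: "nat Perm.perm"
  assumes "affected p \<subseteq> {..N}" "y \<le> N"
  shows "p \<langle>$\<rangle> y \<le> N"
proof (cases "y \<in> affected p")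
  case True
  then have "p \<langle>$\<rangle> y \<in> affected p" by simp
  then show ?thesis using assms(1) by blast
next
  case False
  then show ?thesis using assms by (simp add: in_affected)
qed

lemma rack_act_in_points:
  assumes "affected p \<subseteq> {..N}" "x \<in> points N"
  shows "rack_act p x \<in> points N"
proof (cases x)
  case (Inl q)
  then have "affected q \<subseteq> {..N}"
    using assms by (auto simp: points_def)
  then have "affected (p * q * inverse p) \<subseteq> {..N}"
    using affected_times[of "p * q" "inverse p"] affected_times[of p q] assms(1)
    unfolding affected_inverse by blast
  then show ?thesis using Inl by (simp add: points_def)
next
  case (Inr y)
  then show ?thesis
    using assms apply_closed by (auto simp: points_def)
qed

lemma affected_label: "x \<in> points N \<Longrightarrow> affected (label x) \<subseteq> {..N}"
  by (auto simp: points_def)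

lemma step_in_confs:
  assumes "1 \<le> i" "i < n" "x \<in> confs n N"
  shows "step i e x \<in> confs n N"
  using assms by (auto simp: confs_def step_def rack_act_in_points affected_label)

lemma word_act_in_confs:
  assumes "x \<in> confs n N"
  shows "valid_word n w \<Longrightarrow> word_act w x \<in> confs n N"
  by (induction w) (auto simp: assms step_in_confs)

section \<open>Powers of the generators acting trivially\<close>

text \<open>An injective self-map of a finite set is a permutation of it and so has finite order;
  \<open>p\<close> extends it by the identity outside \<open>S\<close>.\<close>

lemma funpow_id_on_finite:
  assumes "finite S" "inj_on f S" "f ` S \<subseteq> S"
  shows "\<exists>k>0. \<forall>x\<in>S. (f ^^ k) x = x"
proof -
  define p where "p x = (if x \<in> S then f x else x)" for x
  have "p permutes S"
  proof (rule bij_imp_permutes)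
    have "bij_betw f S S"
      using assms by (simp add: bij_betw_def endo_inj_surj)
    then show "bij_betw p S S"
      by (rule bij_betw_cong[THEN iffD1, rotated]) (simp add: p_def)
  qed (simp add: p_def)
  then obtain k where k: "p ^^ k = id" "k > 0"
    using permutation_is_nilpotent permutes_imp_permutation[OF assms(1)] by blast
  have "(f ^^ j) x = (p ^^ j) x \<and> (p ^^ j) x \<in> S" if "x \<in> S" for x j
    using that assms(3) by (induction j) (auto simp: p_def)
  then show ?thesis
    using k by (metis id_apply)
qed

lemma word_act_replicate: "word_act (replicate k (i, e)) x = (step i e ^^ k) x"
  by (induction k) auto

lemma exists_trivial_power:
  "\<exists>k>0. \<forall>i. 1 \<le> i \<longrightarrow> i < n \<longrightarrow> (\<forall>x\<in>confs n N. word_act (replicate k (i, True)) x = x)"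
proof -
  have "\<exists>k>0. \<forall>x\<in>confs n N. (step i True ^^ k) x = x" if "i \<in> {1..<n}" for i
  proof (rule funpow_id_on_finite)
    show "inj_on (step i True) (confs n N)"
      using step_inverse[of i False] by (intro inj_on_inverseI[of _ "step i False"]) simp
  qed (use that in \<open>auto simp: finite_confs step_in_confs\<close>)
  then obtain k where k: "\<And>i. i \<in> {1..<n} \<Longrightarrow> k i > 0"
    "\<And>i x. i \<in> {1..<n} \<Longrightarrow> x \<in> confs n N \<Longrightarrow> (step i True ^^ k i) x = x"
    by metis
  \<comment> \<open>The product of the individual exponents is a multiple of each, hence one
    exponent for all generators.\<close>
  have "(step i True ^^ prod k {1..<n}) x = x" if ix: "i \<in> {1..<n}" "x \<in> confs n N" for i x
  proof -
    obtain d where "prod k {1..<n} = k i * d"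
      using dvd_prodI[OF finite_atLeastLessThan ix(1), of k] by (elim dvdE)
    moreover have "((step i True ^^ k i) ^^ d) x = x"
      using k(2)[OF ix] by (induction d) auto
    ultimately show ?thesis by (simp add: funpow_mult)
  qed
  moreover have "prod k {1..<n} > 0"
    using k(1) by (simp add: prod_pos)
  ultimately show ?thesis
    by (intro exI[of _ "prod k {1..<n}"]) (auto simp: word_act_replicate)
qed

text \<open>The classes acting trivially on \<open>confs n N\<close> form a subgroup
  \<open>?K\<close>. It contains all conjugates of the \<open>k\<close>-th powers of the generators,
  hence the whole subgroup these generate.\<close>

lemma congr_sub_acts_trivially:
  assumes k: "\<And>i x. 1 \<le> i \<Longrightarrow> i < n \<Longrightarrow> x \<in> confs n N \<Longrightarrow>
      word_act (replicate k (i, True)) x = x"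
    and "P \<in> braid_congr_sub n k"
  shows "\<exists>w. valid_word n w \<and> P = braid_class n w \<and> (\<forall>x\<in>confs n N. word_act w x = x)"
proof -
  let ?K = "{P. \<exists>w. valid_word n w \<and> P = braid_class n w \<and> (\<forall>x\<in>confs n N. word_act w x = x)}"
  interpret group "braid_group n" by (rule group_braid_group)
  have "subgroup ?K (braid_group n)"
  proof (rule subgroupI)
    show "?K \<noteq> {}" by (auto intro!: exI[of _ "[]"])
  next
    fix P assume "P \<in> ?K"
    then obtain w where w: "valid_word n w" "P = braid_class n w" "\<forall>x\<in>confs n N. word_act w x = x"
      by blast
    have "word_act (word_inv w) x = x" if "x \<in> confs n N" for x
      using w(3) that word_act_inv[of w x] by simp
    then show "inv\<^bsub>braid_group n\<^esub> P \<in> ?K"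
      using w by (auto simp: inv_braid_class intro!: exI[of _ "word_inv w"])
  next
    fix P Q assume "P \<in> ?K" "Q \<in> ?K"
    then obtain u v where "valid_word n u" "P = braid_class n u" "\<forall>x\<in>confs n N. word_act u x = x"
      "valid_word n v" "Q = braid_class n v" "\<forall>x\<in>confs n N. word_act v x = x"
      by blast
    then show "P \<otimes>\<^bsub>braid_group n\<^esub> Q \<in> ?K"
      by (auto simp: mult_braid_class intro!: exI[of _ "u @ v"])
  qed auto
  moreover have "P \<otimes>\<^bsub>braid_group n\<^esub> (braid_gen n i [^]\<^bsub>braid_group n\<^esub> k)
      \<otimes>\<^bsub>braid_group n\<^esub> inv\<^bsub>braid_group n\<^esub> P \<in> ?K"
    if P: "P \<in> carrier (braid_group n)" and i: "1 \<le> i" "i < n" for P i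
  proof -
    obtain w where w: "valid_word n w" "P = braid_class n w"
      using P by (auto simp: carrier_braid_group)
    let ?r = "replicate k (i, True)"
    have r: "braid_gen n i [^]\<^bsub>braid_group n\<^esub> k = braid_class n ?r" "valid_word n ?r"
      using pow_braid_class[of n "[(i, True)]" k] i by (simp_all add: braid_gen_def)
    have "word_act (w @ ?r @ word_inv w) x = x" if "x \<in> confs n N" for x
    proof -
      have "word_act w (word_act (word_inv w) x) = x"
        using word_act_inv[of "word_inv w" x] by simp
      then show ?thesis
        using k[OF i word_act_in_confs[OF that, of "word_inv w"]] w(1) by simp
    qed
    moreover have "P \<otimes>\<^bsub>braid_group n\<^esub> (braid_gen n i [^]\<^bsub>braid_group n\<^esub> k)
        \<otimes>\<^bsub>braid_group n\<^esub> inv\<^bsub>braid_group n\<^esub> P = braid_class n (w @ ?r @ word_inv w)"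
      using w r by (simp add: inv_braid_class mult_braid_class)
    moreover have "valid_word n (w @ ?r @ word_inv w)"
      using w(1) r(2) by simp
    ultimately show ?thesis by blast
  qed
  ultimately have "braid_congr_sub n k \<subseteq> ?K"
    unfolding braid_congr_sub_def by (intro generate_subgroup_incl) auto
  then show ?thesis using assms(2) by blast
qed

section \<open>Residual finiteness of free groups\<close>

definition free_act :: "(nat \<Rightarrow> nat Perm.perm) \<Rightarrow> bword \<Rightarrow> nat \<Rightarrow> nat" where
  "free_act q w = foldr (\<lambda>(i, e). Perm.apply (if e then q i else inverse (q i))) w"

lemma free_act_simps [simp]:
  "free_act q [] y = y"
  "free_act q ((i, e) # w) y = (if e then q i else inverse (q i)) \<langle>$\<rangle> (free_act q w y)"
  "free_act q (u @ v) y = free_act q u (free_act q v y)"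
  by (simp_all add: free_act_def)

text \<open>Domain and image of a partial injection have equal size, so their complements in
  \<open>S\<close> are in bijection, and any such bijection completes \<open>f\<close>.\<close>

lemma inj_on_extend_permutes:
  assumes "finite S" "D \<subseteq> S" "inj_on f D" "f ` D \<subseteq> S"
  shows "\<exists>p. p permutes S \<and> (\<forall>x\<in>D. p x = f x)"
proof -
  have fin: "finite D" "finite (f ` D)"
    using assms finite_subset by auto
  have "card (S - D) = card (S - f ` D)"
    using assms fin by (simp add: card_Diff_subset card_image)
  then obtain h where h: "bij_betw h (S - D) (S - f ` D)"
    using finite_same_card_bij[of "S - D" "S - f ` D"] assms(1) by auto
  define p where "p x = (if x \<in> D then f x else if x \<in> S then h x else x)" for x
  have "bij_betw p D (f ` D)"
    using assms(3) by (auto simp: p_def bij_betw_def inj_on_def)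
  moreover have "bij_betw p (S - D) (S - f ` D)"
    using h by (rule bij_betw_cong[THEN iffD1, rotated]) (simp add: p_def)
  ultimately have "bij_betw p (D \<union> (S - D)) (f ` D \<union> (S - f ` D))"
    by (rule bij_betw_combine) auto
  then have "bij_betw p S S"
    using assms(2,4) by (simp add: Un_absorb1)
  then have "p permutes S"
    using assms(2) by (intro bij_imp_permutes) (auto simp: p_def)
  then show ?thesis
    by (auto simp: p_def)
qed

definition reduced :: "bword \<Rightarrow> bool" where
  "reduced w \<longleftrightarrow> (\<forall>t. Suc t < length w \<longrightarrow> w ! Suc t \<noteq> (fst (w ! t), \<not> snd (w ! t)))"

text \<open>The permutations are chosen so that \<open>w\<close> walks along \<open>length w, \<dots>, 1, 0\<close>: being
  reduced says exactly that the required partial maps are well defined and injective.\<close>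

lemma reduced_acts_nontrivially:
  assumes "reduced w"
  shows "\<exists>q. (\<forall>i. affected (q i) \<subseteq> {..length w}) \<and> free_act q w (length w) = 0"
proof -
  define L where "L = length w"
  have red: "w ! Suc t \<noteq> (i, \<not> e)" if "w ! t = (i, e)" "Suc t < L" for t i e
    using assms that by (auto simp: reduced_def L_def)
  \<comment> \<open>The permutation for \<open>i\<close> must send \<open>t + 1\<close> to
    \<open>t\<close> if letter \<open>t\<close> is \<open>(i, True)\<close>, and \<open>t\<close> to
    \<open>t + 1\<close> if it is \<open>(i, False)\<close>. \<open>D i\<close> collects the points
    where this prescribes a value and \<open>f i\<close> gives the value; \<open>0 < s\<close>
    guards the truncated \<open>s - 1\<close>.\<close>
  define D where "D i = {s. s \<le> L \<and> (0 < s \<and> w ! (s - 1) = (i, True) \<or> s < L \<and> w ! s = (i, False))}" for i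
  define f where "f i s = (if 0 < s \<and> w ! (s - 1) = (i, True) then s - 1 else Suc s)" for i s
  have "\<exists>p. p permutes {..L} \<and> (\<forall>x\<in>D i. p x = f i x)" for i
  proof (rule inj_on_extend_permutes)
    \<comment> \<open>Letters \<open>(i, False)\<close> at \<open>t\<close> and
      \<open>(i, True)\<close> at \<open>t + 1\<close> would send both \<open>t\<close> and
      \<open>s = t + 2\<close> to \<open>t + 1\<close>; being reduced excludes this.\<close>
    have mixed: False if "w ! (s - 1) = (i, True)" "w ! t = (i, False)" "s - 1 = Suc t" "s \<le> L" for s t
      using red[OF that(2)] that by simp
    show "inj_on (f i) (D i)"
    proof (rule inj_onI)
      fix s t
      assume st: "s \<in> D i" "t \<in> D i" "f i s = f i t"
      let ?down = "\<lambda>s. 0 < s \<and> w ! (s - 1) = (i, True)"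
      have dom: "s \<le> L" "t \<le> L" "?down s \<or> w ! s = (i, False)" "?down t \<or> w ! t = (i, False)"
        using st(1,2) unfolding D_def by blast+
      show "s = t"
      proof (cases "?down s"; cases "?down t")
        assume "?down s" "?down t"
        then show ?thesis using st(3) by (auto simp: f_def)
      next
        assume *: "?down s" "\<not> ?down t"
        then have "s - 1 = Suc t" using st(3) unfolding f_def by (simp only: if_True if_False simp_thms)
        then show ?thesis using mixed[of s t] * dom by blast
      next
        assume *: "\<not> ?down s" "?down t"
        then have "t - 1 = Suc s" using st(3) unfolding f_def by (simp only: if_True if_False simp_thms)
        then show ?thesis using mixed[of t s] * dom by blast
      next
        assume "\<not> ?down s" "\<not> ?down t"
        then show ?thesis using st(3) unfolding f_def by (simp only: if_False nat.inject)
      qed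
    qed
  qed (auto simp: D_def f_def)
  then obtain p where p: "\<And>i. p i permutes {..L}" "\<And>i x. x \<in> D i \<Longrightarrow> p i x = f i x"
    by metis
  define q where "q i = Perm (p i)" for i
  have fix_out: "{a. p i a \<noteq> a} \<subseteq> {..L}" for i
    using permutes_not_in[OF p(1)[of i]] by auto
  then have "finite {a. p i a \<noteq> a}" for i
    by (rule finite_subset) simp
  then have app: "q i \<langle>$\<rangle> x = p i x" for i x
    using permutes_bij[OF p(1)[of i]] by (simp add: q_def Perm_inverse)
  have letter: "(if e then q i else inverse (q i)) \<langle>$\<rangle> (Suc t) = t" if "t < L" "w ! t = (i, e)" for t i e
  proof (cases e)
    case True
    then have "Suc t \<in> D i" "f i (Suc t) = t"
      using that by (auto simp: D_def f_def)
    then show ?thesis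
      using True p(2) app by simp
  next
    case False
    then have "t \<in> D i"
      using that by (auto simp: D_def)
    \<comment> \<open>Well-definedness: for positive \<open>t\<close>, a letter
      \<open>(i, True)\<close> at \<open>t - 1\<close> would cancel against the one at
      \<open>t\<close>.\<close>
    moreover have "f i t = Suc t"
      using that False red[of "t - 1" i True] by (auto simp: f_def)
    ultimately have "q i \<langle>$\<rangle> t = Suc t"
      using p(2) app by simp
    then have "inverse (q i) \<langle>$\<rangle> (Suc t) = t"
      by (metis apply_inverse_cancel(2))
    then show ?thesis
      using False by simp
  qed
  \<comment> \<open>The last letter acts first, so each suffix leads from \<open>L\<close> down to
    its starting index.\<close>
  have "free_act q (drop t w) L = t" if "t \<le> L" for t
    using that
  proof (induction rule: inc_induct)
    case base
    then show ?case by (simp add: L_def)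
  next
    case (step t)
    obtain i e where ie: "w ! t = (i, e)" by fastforce
    have "drop t w = (i, e) # drop (Suc t) w"
      using step ie by (simp add: L_def flip: Cons_nth_drop_Suc)
    then show ?case
      using step letter[OF _ ie] by simp
  qed
  from this[of 0] have "free_act q w (length w) = 0"
    by (simp add: L_def)
  moreover have "affected (q i) \<subseteq> {..length w}" for i
    using fix_out[of i] by (auto simp: in_affected app L_def)
  ultimately show ?thesis by blast
qed

text \<open>Residual finiteness as an induction rule: a word trivial in all these finite actions
  shrinks to \<open>[]\<close> by deleting cancelling pairs. Deletion preserves the action, and a
  reduced word sends its length to \<open>0\<close> for some \<open>q\<close>, so a reduced trivial
  word is empty.\<close>

lemma trivial_free_act_induct:
  assumes "\<And>q N y. (\<And>i. affected (q i) \<subseteq> {..N}) \<Longrightarrow> y \<le> N \<Longrightarrow> free_act q w y = y"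
    and "P []"
    and "\<And>u i e v. P (u @ v) \<Longrightarrow> P (u @ (i, e) # (i, \<not> e) # v)"
  shows "P w"
  using assms(1)
proof (induction "length w" arbitrary: w rule: less_induct)
  case less
  show ?case
  proof (cases "reduced w")
    case True
    then obtain q where q: "\<And>i. affected (q i) \<subseteq> {..length w}" "free_act q w (length w) = 0"
      using reduced_acts_nontrivially by blast
    then have "w = []"
      using less.prems[of q "length w" "length w"] by simp
    then show ?thesis
      using assms(2) by simp
  next
    case False
    then obtain t where t: "Suc t < length w" "w ! Suc t = (fst (w ! t), \<not> snd (w ! t))"
      by (auto simp: reduced_def)
    obtain i e where ie: "w ! t = (i, e)" by fastforce
    let ?u = "take t w" and ?v = "drop (Suc (Suc t)) w"
    have "drop t w = (i, e) # (i, \<not> e) # ?v"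
      using t ie by (simp add: Cons_nth_drop_Suc[symmetric])
    then have w: "w = ?u @ (i, e) # (i, \<not> e) # ?v"
      by (metis append_take_drop_id)
    have "P (?u @ ?v)"
    proof (rule less.hyps)
      show "length (?u @ ?v) < length w"
        using t by simp
      fix q :: "nat \<Rightarrow> nat Perm.perm" and N y
      assume "\<And>i. affected (q i) \<subseteq> {..N}" "y \<le> N"
      then have "free_act q w y = y"
        by (rule less.prems)
      then have "free_act q (?u @ (i, e) # (i, \<not> e) # ?v) y = y"
        by (simp flip: w)
      then show "free_act q (?u @ ?v) y = y"
        by (cases e) simp_all
    qed
    then show ?thesis
      using assms(3) w by metis
  qed
qed

section \<open>Faithfulness\<close>

text \<open>The word g_m ... g_j, which represents the coset element \<open>c j\<close> of the
  combing; \<open>pure_gen m j\<close> likewise represents \<open>A j\<close>.\<close>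

definition sweep :: "nat \<Rightarrow> nat \<Rightarrow> bword" where
  "sweep m j = map (\<lambda>i. (i, True)) (rev [j..<Suc m])"

definition pure_gen :: "nat \<Rightarrow> nat \<Rightarrow> bword" where
  "pure_gen m j = sweep m (Suc j) @ [(j, True), (j, True)] @ word_inv (sweep m (Suc j))"

lemma sweep_top [simp]: "sweep m (Suc m) = []"
  by (simp add: sweep_def)

lemma sweep_rec: "j \<le> m \<Longrightarrow> sweep m j = sweep m (Suc j) @ [(j, True)]"
  by (simp add: sweep_def upt_conv_Cons del: upt_Suc)

lemma valid_sweep [simp]: "1 \<le> j \<Longrightarrow> valid_word (Suc m) (sweep m j)"
  by (auto simp: sweep_def valid_word_def)

lemma valid_pure_gen [simp]: "1 \<le> j \<Longrightarrow> j \<le> m \<Longrightarrow> valid_word (Suc m) (pure_gen m j)"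
  by (simp add: pure_gen_def)

lemma valid_word_Suc: "valid_word m w \<Longrightarrow> valid_word (Suc m) w"
  by (auto simp: valid_word_def)

text \<open>Carries the triviality of \<open>v\<close>, obtained by induction in
  \<open>word_act_faithful\<close>, up to one more strand.\<close>

lemma braid_eq_Suc: "braid_eq m u v \<Longrightarrow> braid_eq (Suc m) u v"
proof (induction rule: braid_eq.induct)
  case (sym u v)
  show ?case by (rule braid_eq.sym[OF sym.IH])
next
  case (trans u v w)
  show ?case by (rule braid_eq.trans[OF trans.IH])
next
  case (ctxt u v a b)
  show ?case by (rule braid_eq.ctxt[OF ctxt.IH])
qed (auto simp del: Suc_eq_plus1 add_Suc_right intro!: braid_eq.refl braid_eq.cancel braid_eq.comm braid_eq.braid[simplified])

lemma braid_combing_braid_group: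
  "braid_combing (braid_group (Suc m)) (braid_gen (Suc m)) (\<lambda>j. braid_class (Suc m) (sweep m j)) m"
proof -
  interpret group "braid_group (Suc m)" by (rule group_braid_group)
  show ?thesis
    by unfold_locales
      (use braid_eq.braid[of _ "Suc m"] in \<open>auto simp: braid_gen_def mult_braid_class
        braid_class_eq_iff one_braid_group sweep_rec intro: braid_eq.comm\<close>)
qed

text \<open>Transfers \<open>generate_subset_combed\<close> to words: each class is a product of
  generators, hence combed, and \<open>generate_braid_class\<close> provides words for the factors
  from \<open>U\<close> and \<open>B\<close>.\<close>

lemma braid_combed_form:
  assumes "valid_word (Suc m) w"
  shows "\<exists>a v j. valid_word (Suc m) a \<and> valid_word m v \<and> 1 \<le> j \<and> j \<le> Suc m \<and>
    braid_eq (Suc m) w (word_subst (pure_gen m) a @ v @ sweep m j)"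
proof -
  interpret braid_combing "braid_group (Suc m)" "braid_gen (Suc m)"
    "\<lambda>j. braid_class (Suc m) (sweep m j)" m
    by (rule braid_combing_braid_group)
  let ?G = "braid_group (Suc m)"
  have "braid_class (Suc m) w \<in> generate ?G (braid_gen (Suc m) ` {1..m})"
    using assms
  proof (induction w)
    case Nil
    then show ?case
      by (simp add: generate.one flip: one_braid_group)
  next
    case (Cons l w)
    obtain i e where l: "l = (i, e)" by fastforce
    have i: "1 \<le> i" "i \<le> m" and w: "valid_word (Suc m) w"
      using Cons.prems l by auto
    have "braid_class (Suc m) [(i, e)] \<in> generate ?G (braid_gen (Suc m) ` {1..m})"
    proof (cases e)
      case True
      then show ?thesis
        using i by (intro generate.incl) (auto simp: braid_gen_def)
    next
      case False
      then have "braid_class (Suc m) [(i, e)] = inv\<^bsub>?G\<^esub> (braid_gen (Suc m) i)"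
        using i by (simp add: braid_gen_def inv_braid_class)
      then show ?thesis
        using i by (auto intro: generate.inv)
    qed
    moreover have "braid_class (Suc m) (l # w) = braid_class (Suc m) [(i, e)] \<otimes>\<^bsub>?G\<^esub> braid_class (Suc m) w"
      using i w l by (simp add: mult_braid_class)
    ultimately show ?case
      using generate.eng Cons.IH[OF w] by metis
  qed
  with generate_subset_combed have "braid_class (Suc m) w \<in> combed" ..
  then obtain u b j where
    ubj: "braid_class (Suc m) w = u \<otimes>\<^bsub>?G\<^esub> b \<otimes>\<^bsub>?G\<^esub> braid_class (Suc m) (sweep m j)"
      "u \<in> U" "b \<in> B" "1 \<le> j" "j \<le> Suc m"
    by (rule combedE)
  have "A i = braid_class (Suc m) (pure_gen m i)" if "i \<in> {1..<Suc m}" for i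
    using that by (simp add: A_def braid_gen_def pure_gen_def mult_braid_class inv_braid_class)
  then have "A ` {1..m} = (\<lambda>i. braid_class (Suc m) (pure_gen m i)) ` {1..<Suc m}"
    unfolding atLeastLessThanSuc_atLeastAtMost[symmetric] by (rule image_cong[OF HOL.refl])
  then obtain a where a: "valid_word (Suc m) a" "u = braid_class (Suc m) (word_subst (pure_gen m) a)"
    using generate_braid_class[of u "Suc m" "pure_gen m" "Suc m"] ubj(2) by auto
  obtain v' where v': "valid_word m v'"
      "b = braid_class (Suc m) (word_subst (\<lambda>i. [(i, True)]) v')"
    using generate_braid_class[of b "Suc m" "\<lambda>i. [(i, True)]" m] ubj(3)
    by (auto simp: braid_gen_def)
  \<comment> \<open>For \<open>B\<close> the generators are substituted for themselves.\<close>
  have "word_subst (\<lambda>i. [(i, True)]) v' = v'"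
    by (induction v') auto
  with v' have v: "valid_word m v'" "b = braid_class (Suc m) v'"
    by auto
  have "valid_word (Suc m) (word_subst (pure_gen m) a)"
    using a(1) by (rule valid_word_subst[rotated]) simp
  then show ?thesis
    using a v ubj(1,4,5) assms valid_word_Suc[OF v(1)]
    by (intro exI[of _ a] exI[of _ v'] exI[of _ j]) (simp add: mult_braid_class braid_class_eq_iff)
qed

section \<open>Following a marked number through a configuration\<close>

definition insert_at :: "nat \<Rightarrow> nat \<Rightarrow> (nat \<Rightarrow> point) \<Rightarrow> nat \<Rightarrow> point" where
  "insert_at j y x i = (if i < j then x i else if i = j then Inr y else x (i - 1))"

text \<open>A number acts trivially, so moving right it leaves the entry it passes unchanged and
  keeps its value; moving left past \<open>x j\<close> it is acted on by that entry.\<close>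

lemma step_insert_at:
  "step j True (insert_at j y x) = insert_at (Suc j) y x"
  "step j True (insert_at (Suc j) y x) = insert_at j (label (x j) \<langle>$\<rangle> y) x"
  by (auto simp: step_def insert_at_def fun_eq_iff)

lemma word_act_sweep:
  assumes "j \<le> Suc m"
  shows "word_act (sweep m j) (insert_at j y x) = insert_at (Suc m) y x"
  using assms
proof (induction rule: inc_induct)
  case (step j)
  then show ?case
    by (simp add: sweep_rec step_insert_at)
qed simp

text \<open>The inverse sweep takes \<open>y\<close> from the top to position \<open>j + 1\<close>,
  the two letters g_j take it left past \<open>x j\<close>, where it is acted on, and back again,
  and the sweep returns it to the top.\<close>

lemma word_act_pure_gen:
  assumes "j \<le> m"
  shows "word_act (pure_gen m j) (insert_at (Suc m) y x) = insert_at (Suc m) (label (x j) \<langle>$\<rangle> y) x"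
proof -
  have "word_act (word_inv (sweep m (Suc j))) (insert_at (Suc m) y x) = insert_at (Suc j) y x"
    using word_act_sweep[of "Suc j" m y x] word_act_inv[of "sweep m (Suc j)" "insert_at (Suc j) y x"] assms
    by simp
  then show ?thesis
    using word_act_sweep[of "Suc j" m _ x] assms by (simp add: pure_gen_def step_insert_at)
qed

text \<open>Each pure generator leaves \<open>x\<close> alone, so the letters act on
  \<open>y\<close> by fixed permutations, the labels of \<open>x\<close>, as a word of a free group
  does.\<close>

lemma word_act_pure_word:
  assumes "valid_word (Suc m) a"
  shows "word_act (word_subst (pure_gen m) a) (insert_at (Suc m) y x)
    = insert_at (Suc m) (free_act (\<lambda>i. label (x i)) a y) x"
  using assms
proof (induction a)
  case (Cons l a)
  obtain i e where l: "l = (i, e)" by fastforce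
  have "word_act (word_inv (pure_gen m i)) (insert_at (Suc m) z x)
      = insert_at (Suc m) (inverse (label (x i)) \<langle>$\<rangle> z) x" if "i \<le> m" for z
    using word_act_pure_gen[OF that, of "inverse (label (x i)) \<langle>$\<rangle> z" x]
      word_act_inv[of "pure_gen m i" "insert_at (Suc m) (inverse (label (x i)) \<langle>$\<rangle> z) x"] by simp
  then show ?case
    using Cons l by (simp add: word_act_pure_gen)
qed simp

text \<open>Letters of index below \<open>m\<close> touch only positions up to
  \<open>m\<close>.\<close>

lemma word_act_insert_top:
  "valid_word m v \<Longrightarrow> word_act v (insert_at (Suc m) y x) = insert_at (Suc m) y (word_act v x)"
proof (induction v)
  case (Cons l v)
  have "step i e (insert_at (Suc m) y z) = insert_at (Suc m) y (step i e z)" if "i < m" for i e z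
    using that by (auto simp: step_def insert_at_def fun_eq_iff)
  then show ?case
    using Cons by (cases l) simp
qed simp

lemma insert_at_inject: "insert_at j y x = insert_at j y' x' \<longleftrightarrow> y = y' \<and> x = x'"
proof
  assume eq: "insert_at j y x = insert_at j y' x'"
  have "x i = x' i" for i
    using fun_cong[OF eq, of i] fun_cong[OF eq, of "Suc i"]
    by (cases "i < j") (auto simp: insert_at_def split: if_splits)
  then show "y = y' \<and> x = x'"
    using fun_cong[OF eq, of j] by (auto simp: insert_at_def)
qed simp

lemma insert_at_in_confs:
  assumes "x \<in> confs m N" "y \<le> N" "1 \<le> j" "j \<le> Suc m"
  shows "insert_at j y x \<in> confs (Suc m) N"
proof -
  have "Inr y \<in> points N"
    using assms(2) by (simp add: points_def)
  have x: "1 \<le> i \<Longrightarrow> i \<le> m \<Longrightarrow> x i \<in> points N" "i < 1 \<or> m < i \<Longrightarrow> x i = Inr 0" for i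
  proof -
    have "(i \<in> {1..m} \<longrightarrow> x i \<in> points N) \<and> (i \<notin> {1..m} \<longrightarrow> x i = Inr 0)"
      using assms(1) unfolding confs_def by blast
    then show "1 \<le> i \<Longrightarrow> i \<le> m \<Longrightarrow> x i \<in> points N" "i < 1 \<or> m < i \<Longrightarrow> x i = Inr 0"
      unfolding atLeastAtMost_iff using not_le by blast+
  qed
  have "(i \<in> {1..Suc m} \<longrightarrow> insert_at j y x i \<in> points N) \<and>
      (i \<notin> {1..Suc m} \<longrightarrow> insert_at j y x i = Inr 0)" for i
  proof (cases i j rule: linorder_cases)
    case less
    then show ?thesis
      using x[of i] assms(4) by (cases i) (simp_all add: insert_at_def)
  next
    case equal
    then show ?thesis
      using \<open>Inr y \<in> points N\<close> assms(3,4) by (simp add: insert_at_def)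
  next
    case greater
    then have "1 \<le> i - 1"
      using assms(3) by simp
    then show ?thesis
      using greater x[of "i - 1"] by (simp add: insert_at_def)
  qed
  then show ?thesis
    by (simp add: confs_def)
qed

theorem word_act_faithful:
  assumes "valid_word n w" "\<And>N x. x \<in> confs n N \<Longrightarrow> word_act w x = x"
  shows "braid_eq n w []"
  using assms
proof (induction n arbitrary: w)
  case 0
  then have "w = []"
    by (cases w) auto
  then show ?case
    by (simp add: braid_eq.refl)
next
  case (Suc m)
  obtain a v j where avj: "valid_word (Suc m) a" "valid_word m v" "1 \<le> j" "j \<le> Suc m"
      "braid_eq (Suc m) w (word_subst (pure_gen m) a @ v @ sweep m j)"
    using braid_combed_form[OF Suc.prems(1)] by blast
  \<comment> \<open>Reading the combed word from the right, the sweep carries \<open>y\<close> from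
    \<open>j\<close> to the top, \<open>v\<close> acts on the other entries, and the pure word acts
    on \<open>y\<close> with the labels found after \<open>v\<close>.\<close>
  have act: "insert_at (Suc m) (free_act (\<lambda>i. label (word_act v x i)) a y) (word_act v x)
      = insert_at j y x" if "x \<in> confs m N" "y \<le> N" for x y N
  proof -
    have "insert_at j y x = word_act (word_subst (pure_gen m) a @ v @ sweep m j) (insert_at j y x)"
      using Suc.prems(2)[OF insert_at_in_confs[OF that avj(3,4)]] word_act_cong[OF avj(5)] by simp
    then show ?thesis
      using avj by (simp add: word_act_sweep word_act_insert_top word_act_pure_word)
  qed
  have "j = Suc m"
  proof (rule ccontr)
    assume "j \<noteq> Suc m"
    \<comment> \<open>All labels here are trivial, so braids only move the marked number
      \<open>1\<close>, which differs from the entries \<open>0\<close> and reveals its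
      position.\<close>
    let ?x = "\<lambda>_. Inr 0 :: point"
    have "step i e ?x = ?x" for i e
      by (auto simp: step_def)
    then have v: "word_act v ?x = ?x"
      by (induction v) auto
    have "free_act (\<lambda>i. label (?x i)) a 1 = 1"
      by (induction a) (auto simp: apply_inverse)
    moreover have "?x \<in> confs m 1"
      by (simp add: confs_def points_def)
    ultimately have "insert_at (Suc m) 1 ?x = insert_at j 1 ?x"
      using act[of ?x 1 1] by (simp add: v)
    from fun_cong[OF this, of "Suc m"] show False
      using \<open>j \<noteq> Suc m\<close> avj(4) by (simp add: insert_at_def)
  qed
  \<comment> \<open>Now \<open>y\<close> starts and ends at the top, so both components can be
    compared. As \<open>v\<close> fixes \<open>x\<close>, the labels seen by \<open>a\<close> are
    those of \<open>x\<close> itself.\<close>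
  have v_fix: "word_act v x = x" and a_fix: "y \<le> N \<Longrightarrow> free_act (\<lambda>i. label (x i)) a y = y"
    if "x \<in> confs m N" for x y N
  proof -
    show v: "word_act v x = x"
      using act[OF that, of 0] \<open>j = Suc m\<close> by (simp add: insert_at_inject)
    show "free_act (\<lambda>i. label (x i)) a y = y" if "y \<le> N"
      using act[OF \<open>x \<in> confs m N\<close> that] \<open>j = Suc m\<close> by (simp add: insert_at_inject v)
  qed
  have "braid_eq (Suc m) v []"
    using Suc.IH[OF avj(2)] v_fix braid_eq_Suc by blast
  moreover have "braid_eq (Suc m) (word_subst (pure_gen m) a) []"
  proof -
    have "valid_word (Suc m) a \<longrightarrow> braid_eq (Suc m) (word_subst (pure_gen m) a) []"
    proof (rule trivial_free_act_induct[where w = a])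
      fix q :: "nat \<Rightarrow> nat Perm.perm" and N y
      assume q: "\<And>i. affected (q i) \<subseteq> {..N}" and y: "y \<le> N"
      \<comment> \<open>Permutation entries make the labels agree with the given \<open>q\<close> on
        \<open>{1..m}\<close>, the indices occurring in \<open>a\<close>; elsewhere
        \<open>confs\<close> demands \<open>Inr 0\<close>.\<close>
      let ?x = "\<lambda>i. if i \<in> {1..m} then Inl (q i) else Inr 0"
      have "?x \<in> confs m N"
        using q by (auto simp: confs_def points_def)
      from a_fix[OF this y] have "free_act (\<lambda>i. label (?x i)) a y = y" .
      moreover have "free_act (\<lambda>i. label (?x i)) b z = free_act q b z" if "valid_word (Suc m) b" for b z
        using that by (induction b) auto
      ultimately show "free_act q a y = y"
        using avj(1) by simp
    next
      fix u i e v
      assume IH: "valid_word (Suc m) (u @ v) \<longrightarrow> braid_eq (Suc m) (word_subst (pure_gen m) (u @ v)) []"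
      show "valid_word (Suc m) (u @ (i, e) # (i, \<not> e) # v) \<longrightarrow>
          braid_eq (Suc m) (word_subst (pure_gen m) (u @ (i, e) # (i, \<not> e) # v)) []"
      proof
        assume valid: "valid_word (Suc m) (u @ (i, e) # (i, \<not> e) # v)"
        then have "valid_word (Suc m) (pure_gen m i)"
          by simp
        then have "braid_eq (Suc m) (word_subst (pure_gen m) [(i, e), (i, \<not> e)]) []"
          by (cases e) (simp_all add: braid_eq_word_inv_right braid_eq_word_inv_left)
        from braid_eq.ctxt[OF this, of "word_subst (pure_gen m) u" "word_subst (pure_gen m) v"]
        show "braid_eq (Suc m) (word_subst (pure_gen m) (u @ (i, e) # (i, \<not> e) # v)) []"
          using IH valid by (auto intro: braid_eq.trans)
      qed
    qed (simp add: braid_eq.refl)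
    then show ?thesis
      using avj(1) by simp
  qed
  ultimately have "braid_eq (Suc m) (word_subst (pure_gen m) a @ v) []"
    using braid_eq_append by fastforce
  then show ?case
    using avj(5) \<open>j = Suc m\<close> braid_eq.trans by auto
qed

section \<open>The intersection of the normal subgroups\<close>

theorem theorem1p1:
  fixes n :: nat
  assumes "n \<ge> 2"
  shows "(\<Inter>k\<in>{1..}. braid_congr_sub n k) = {\<one>\<^bsub>braid_group n\<^esub>}"
proof
  show "{\<one>\<^bsub>braid_group n\<^esub>} \<subseteq> (\<Inter>k\<in>{1..}. braid_congr_sub n k)"
    by (auto simp: braid_congr_sub_def intro: generate.one)
  show "(\<Inter>k\<in>{1..}. braid_congr_sub n k) \<subseteq> {\<one>\<^bsub>braid_group n\<^esub>}"
  proof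
    fix P
    assume P: "P \<in> (\<Inter>k\<in>{1..}. braid_congr_sub n k)"
    \<comment> \<open>Each \<open>N\<close> calls for its own exponent \<open>k\<close>, which is
      why membership for all \<open>k\<close> is used.\<close>
    have trivial: "\<exists>w. valid_word n w \<and> P = braid_class n w \<and> (\<forall>x\<in>confs n N. word_act w x = x)" for N
    proof -
      obtain k where k: "k > 0"
        "\<And>i x. 1 \<le> i \<Longrightarrow> i < n \<Longrightarrow> x \<in> confs n N \<Longrightarrow> word_act (replicate k (i, True)) x = x"
        using exists_trivial_power[of n N] by auto
      then have "P \<in> braid_congr_sub n k"
        using P by auto
      with k(2) show ?thesis
        by (rule congr_sub_acts_trivially)
    qed
    then obtain w where w: "valid_word n w" "P = braid_class n w" by blast
    have "word_act w x = x" if "x \<in> confs n N" for N x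
    proof -
      \<comment> \<open>The representative \<open>v\<close> obtained for this \<open>N\<close> may
        differ from the fixed \<open>w\<close>, but both represent \<open>P\<close> and therefore
        act alike.\<close>
      obtain v where "valid_word n v" "P = braid_class n v" "\<forall>x\<in>confs n N. word_act v x = x"
        using trivial by blast
      then show ?thesis
        using w that word_act_cong[of n w v x] by (simp add: braid_class_eq_iff)
    qed
    then have "braid_eq n w []"
      using w(1) word_act_faithful by blast
    then show "P \<in> {\<one>\<^bsub>braid_group n\<^esub>}"
      using w by (simp add: one_braid_group braid_class_eq_iff)
  qed
qed

end
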